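(* Let $\beta,\gamma\in(0,1)$, let the supply and demand assumptions in the context hold, and let $p_L<p_{\rm bal}<p_H$. Put $\rho:=\dfrac{c(p_H)}{w(\gamma p_L)}$. Then the pure strategy Nash equilibria of the throughput maximization game between the two platforms are as follows (the first entry of a strategy pair is Platform 1's price, the second is Platform 2's price): 1. $(L,L)$ is a Nash equilibrium iff $\max\{\rho,0\}\le\beta\le\min\{1-\rho,1\}$. 2. $(L,H)$ is a Nash equilibrium iff $\max\{1-\rho,0\}\le\beta\le\min\{\frac1\rho,1\}$. 3. $(H,L)$ is a Nash equilibrium iff $\max\{1-\frac1\rho,0\}\le\beta\le\min\{\rho,1\}$. 4. $(H,H)$ is a Nash equilibrium iff $\max\{\frac1\rho,0\}\le\beta\le\min\{1-\frac1\rho,1\}$.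
   Context: Supply and demand assumptions. $w(p)>0$ (supply) and $c(p)>0$ (demand) are real-valued functions of the price $p>0$; $c$ is strictly decreasing, $w$ is strictly increasing; $0<p_L<p_H$; there is a unique price $p_{\rm bal}$ with $w(\gamma p_{\rm bal})=c(p_{\rm bal})$. Throughput game. Two platforms simultaneously choose a strategy in $\{L,H\}$, i.e. a price $p_1$ (Platform 1), $p_2$ (Platform 2) in $\{p_L,p_H\}$. Given $(p_1,p_2)$, the throughput of Platform 1 is $$N_1(p_1,p_2)=\min\Big\{w(\gamma p_1),\tfrac{\beta}{1-\beta}w(\gamma p_2),c(p_1),\tfrac{\beta}{1-\beta}c(p_2),\beta c(\min\{p_1,p_2\}),\beta w(\max\{\gamma p_1,\gamma p_2\})\Big\}$$ and the throughput of Platform 2 is $N_2(p_1,p_2)=\frac{1-\beta}{\beta}N_1(p_1,p_2)$. (These are the numbers of matched worker–customer pairs at the two platforms in the aggregate-utility-maximizing allocation of users under customer loyalty $\beta$.) The payoff of Platform $i$ is its throughput $N_i$. A pair of strategies is a (pure strategy) Nash equilibrium if no platform can strictly increase its payoff by a unilateral change of strategy. *)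

theory Defs
  imports Complex_Main
begin

text \<open>Prices are positive reals, so supply \<open>w\<close> and demand \<open>c\<close> are total functions on the reals
  that are constrained on \<open>{0<..}\<close> only.\<close>

definition supply_demand :: "(real \<Rightarrow> real) \<Rightarrow> (real \<Rightarrow> real) \<Rightarrow> bool" where
  "supply_demand w c \<longleftrightarrow>
     (\<forall>p>0. w p > 0) \<and> (\<forall>p>0. c p > 0) \<and>
     strict_mono_on {0<..} w \<and> strict_antimono_on {0<..} c"

definition balance_price :: "(real \<Rightarrow> real) \<Rightarrow> (real \<Rightarrow> real) \<Rightarrow> real \<Rightarrow> real \<Rightarrow> bool" where
  "balance_price w c \<gamma> pbal \<longleftrightarrow>
     pbal > 0 \<and> w (\<gamma> * pbal) = c pbal \<and>
     (\<forall>p>0. w (\<gamma> * p) = c p \<longrightarrow> p = pbal)"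

definition throughput1 ::
    "(real \<Rightarrow> real) \<Rightarrow> (real \<Rightarrow> real) \<Rightarrow> real \<Rightarrow> real \<Rightarrow> real \<Rightarrow> real \<Rightarrow> real" where
  "throughput1 w c \<beta> \<gamma> p1 p2 = Min
     {w (\<gamma> * p1), \<beta> / (1 - \<beta>) * w (\<gamma> * p2),
      c p1, \<beta> / (1 - \<beta>) * c p2,
      \<beta> * c (min p1 p2), \<beta> * w (max (\<gamma> * p1) (\<gamma> * p2))}"

definition throughput2 ::
    "(real \<Rightarrow> real) \<Rightarrow> (real \<Rightarrow> real) \<Rightarrow> real \<Rightarrow> real \<Rightarrow> real \<Rightarrow> real \<Rightarrow> real" where
  "throughput2 w c \<beta> \<gamma> p1 p2 = (1 - \<beta>) / \<beta> * throughput1 w c \<beta> \<gamma> p1 p2"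

definition pure_nash ::
    "'s set \<Rightarrow> ('s \<Rightarrow> 's \<Rightarrow> real) \<Rightarrow> ('s \<Rightarrow> 's \<Rightarrow> real) \<Rightarrow> 's \<times> 's \<Rightarrow> bool" where
  "pure_nash S u1 u2 = (\<lambda>(s1, s2).
     s1 \<in> S \<and> s2 \<in> S \<and>
     \<not> (\<exists>t\<in>S. u1 t s2 > u1 s1 s2) \<and>
     \<not> (\<exists>t\<in>S. u2 s1 t > u2 s1 s2))"

text \<open>A strategy is identified with the price it stands for, i.e. \<open>L\<close> with \<open>pL\<close> and
  \<open>H\<close> with \<open>pH\<close>.\<close>

definition throughput_nash ::
    "(real \<Rightarrow> real) \<Rightarrow> (real \<Rightarrow> real) \<Rightarrow> real \<Rightarrow> real \<Rightarrow> real \<Rightarrow> real \<Rightarrow> real \<times> real \<Rightarrow> bool" where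
  "throughput_nash w c \<beta> \<gamma> pL pH =
     pure_nash {pL, pH} (throughput1 w c \<beta> \<gamma>) (throughput2 w c \<beta> \<gamma>)"

end

theory Submission
  imports Defs
begin

text \<open>Write \<open>a = w (\<gamma> * pL)\<close> for the supply at the low price and \<open>b = c pH\<close> for the demand at the
  high price. Because the balance price lies strictly between \<open>pL\<close> and \<open>pH\<close>, monotonicity makes
  \<open>a\<close> and \<open>b\<close> the two scarce quantities: both are smaller than the demand at \<open>pL\<close> and the supply
  at \<open>pH\<close>. Equal prices therefore give platform 1 its loyalty share of the scarce
  side, \<open>\<beta> * a\<close> at \<open>(pL, pL)\<close> and \<open>\<beta> * b\<close> at \<open>(pH, pH)\<close>.

  The throughputs at unequal prices have no such simple form: which of the six terms attains the
  minimum depends on \<open>\<beta>\<close> and on the abundant quantities. But they need not be known. The throughput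
  of platform 2 is a fixed positive multiple of that of platform 1, so both platforms maximize the
  same function, and every unilateral deviation leads between an equal-price and an unequal-price
  profile. Only comparisons of an unequal-price minimum with \<open>\<beta> * a\<close> or \<open>\<beta> * b\<close> matter, and in each
  such comparison five of the six terms exceed the threshold. Which single term can fail depends on
  the profile and on the threshold; the four comparisons

    \<^item> \<open>b / (1 - \<beta>)\<close> with \<open>a\<close> and \<open>a\<close> with \<open>\<beta> * b\<close>, at \<open>(pL, pH)\<close>,
    \<^item> \<open>b\<close> with \<open>\<beta> * a\<close> and \<open>a / (1 - \<beta>)\<close> with \<open>b\<close>, at \<open>(pH, pL)\<close>,

  are, after division by \<open>a\<close> or \<open>b\<close>, the bounds on \<open>\<beta>\<close> in terms of \<open>\<rho> = b / a\<close>.\<close>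

lemma throughput1_le_iff:
  "throughput1 w c \<beta> \<gamma> p1 p2 \<le> x \<longleftrightarrow>
     w (\<gamma> * p1) \<le> x \<or> \<beta> / (1 - \<beta>) * w (\<gamma> * p2) \<le> x \<or>
     c p1 \<le> x \<or> \<beta> / (1 - \<beta>) * c p2 \<le> x \<or>
     \<beta> * c (min p1 p2) \<le> x \<or> \<beta> * w (max (\<gamma> * p1) (\<gamma> * p2)) \<le> x"
  unfolding throughput1_def by (subst Min_le_iff) auto

lemma le_throughput1_iff:
  "x \<le> throughput1 w c \<beta> \<gamma> p1 p2 \<longleftrightarrow>
     x \<le> w (\<gamma> * p1) \<and> x \<le> \<beta> / (1 - \<beta>) * w (\<gamma> * p2) \<and>
     x \<le> c p1 \<and> x \<le> \<beta> / (1 - \<beta>) * c p2 \<and>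
     x \<le> \<beta> * c (min p1 p2) \<and> x \<le> \<beta> * w (max (\<gamma> * p1) (\<gamma> * p2))"
  unfolding throughput1_def by (subst Min_ge_iff) auto

text \<open>The payoffs are positive multiples of each other, so an equilibrium is a profile at which
  \<open>throughput1\<close> cannot be increased by changing one coordinate.\<close>

lemma throughput_nash_iff:
  assumes "0 < \<beta>" "\<beta> < 1"
  shows "throughput_nash w c \<beta> \<gamma> pL pH (p1, p2) \<longleftrightarrow>
    p1 \<in> {pL, pH} \<and> p2 \<in> {pL, pH} \<and>
    (\<forall>t\<in>{pL, pH}. throughput1 w c \<beta> \<gamma> t p2 \<le> throughput1 w c \<beta> \<gamma> p1 p2) \<and>
    (\<forall>t\<in>{pL, pH}. throughput1 w c \<beta> \<gamma> p1 t \<le> throughput1 w c \<beta> \<gamma> p1 p2)"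
proof -
  have "(1 - \<beta>) / \<beta> > 0"
    using assms by simp
  then show ?thesis
    unfolding throughput_nash_def pure_nash_def throughput2_def prod.case
      mult_less_cancel_left_pos[OF \<open>(1 - \<beta>) / \<beta> > 0\<close>]
    by (auto simp: not_less)
qed

text \<open>The consequences of the price order on which the analysis rests: supply is scarce at \<open>pL\<close>
  and demand is scarce at \<open>pH\<close>.\<close>

locale scarce_sides =
  fixes w c :: "real \<Rightarrow> real" and \<beta> \<gamma> pL pH :: real
  assumes beta: "0 < \<beta>" "\<beta> < 1"
    and gamma_pos: "0 < \<gamma>"
    and price_less: "pL < pH"
    and scarce_pos: "0 < w (\<gamma> * pL)" "0 < c pH"
    and scarce_supply: "w (\<gamma> * pL) < c pL" "w (\<gamma> * pL) < w (\<gamma> * pH)"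
    and scarce_demand: "c pH < c pL" "c pH < w (\<gamma> * pH)"
begin

abbreviation "N \<equiv> throughput1 w c \<beta> \<gamma>"

lemma extreme_prices [simp]:
  "min pL pH = pL" "min pH pL = pL"
  "max (\<gamma> * pL) (\<gamma> * pH) = \<gamma> * pH" "max (\<gamma> * pH) (\<gamma> * pL) = \<gamma> * pH"
  using price_less mult_strict_left_mono[OF price_less gamma_pos] by simp_all

text \<open>Of the coefficients \<open>1\<close>, \<open>\<beta> / (1 - \<beta>)\<close> and \<open>\<beta>\<close> in the minimum, the first two exceed \<open>\<beta>\<close>, so
  against the threshold \<open>\<beta> * x\<close> their terms drop out as soon as the quantity is at least \<open>x\<close>. For the
  coefficient \<open>\<beta>\<close> itself the quantity has to be larger than \<open>x\<close>, which is \<open>share_mono\<close> below.\<close>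

lemma share_less:
  assumes "0 < x" "x \<le> y"
  shows "\<beta> * x < y" "\<beta> * x < \<beta> / (1 - \<beta>) * y"
proof -
  have "\<beta> * x < 1 * x"
    using assms beta by (intro mult_strict_right_mono) auto
  then show "\<beta> * x < y"
    using assms by linarith
  have "\<beta> < \<beta> / (1 - \<beta>)"
    using beta by (simp add: field_simps)
  then have "\<beta> * x < \<beta> / (1 - \<beta>) * x"
    using assms by (intro mult_strict_right_mono) auto
  also have "\<dots> \<le> \<beta> / (1 - \<beta>) * y"
    using assms beta by (intro mult_left_mono) auto
  finally show "\<beta> * x < \<beta> / (1 - \<beta>) * y" .
qed

lemma share_mono: "x < y \<Longrightarrow> \<beta> * x < \<beta> * y"
  using beta by simp

lemmas above_supply_share =
  share_less[OF scarce_pos(1) order_refl]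
  share_less[OF scarce_pos(1) less_imp_le[OF scarce_supply(1)]]
  share_less[OF scarce_pos(1) less_imp_le[OF scarce_supply(2)]]
  scarce_supply[THEN share_mono]

lemmas above_demand_share =
  share_less[OF scarce_pos(2) order_refl]
  share_less[OF scarce_pos(2) less_imp_le[OF scarce_demand(1)]]
  share_less[OF scarce_pos(2) less_imp_le[OF scarce_demand(2)]]
  scarce_demand[THEN share_mono]

lemma N_equal_prices:
  "N pL pL = \<beta> * w (\<gamma> * pL)" "N pH pH = \<beta> * c pH"
proof -
  show "N pL pL = \<beta> * w (\<gamma> * pL)"
    by (rule antisym; simp only: throughput1_le_iff le_throughput1_iff min.idem max.idem)
      (use above_supply_share in auto)
  show "N pH pH = \<beta> * c pH"
    by (rule antisym; simp only: throughput1_le_iff le_throughput1_iff min.idem max.idem)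
      (use above_demand_share in auto)
qed

text \<open>Against the supply share, an unequal-price profile can only be limited by its term in the
  scarce demand; against the demand share, only by its term in the scarce supply.\<close>

lemma N_LH_versus_LL:
  "N pL pH \<le> N pL pL \<longleftrightarrow> \<beta> / (1 - \<beta>) * c pH \<le> \<beta> * w (\<gamma> * pL)"
  "N pL pL \<le> N pL pH \<longleftrightarrow> \<beta> * w (\<gamma> * pL) \<le> \<beta> / (1 - \<beta>) * c pH"
  unfolding N_equal_prices throughput1_le_iff le_throughput1_iff extreme_prices
  using above_supply_share by argo+

lemma N_HL_versus_LL:
  "N pH pL \<le> N pL pL \<longleftrightarrow> c pH \<le> \<beta> * w (\<gamma> * pL)"
  "N pL pL \<le> N pH pL \<longleftrightarrow> \<beta> * w (\<gamma> * pL) \<le> c pH"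
  unfolding N_equal_prices throughput1_le_iff le_throughput1_iff extreme_prices
  using above_supply_share by argo+

lemma N_LH_versus_HH:
  "N pL pH \<le> N pH pH \<longleftrightarrow> w (\<gamma> * pL) \<le> \<beta> * c pH"
  "N pH pH \<le> N pL pH \<longleftrightarrow> \<beta> * c pH \<le> w (\<gamma> * pL)"
  unfolding N_equal_prices throughput1_le_iff le_throughput1_iff extreme_prices
  using above_demand_share by argo+

lemma N_HL_versus_HH:
  "N pH pL \<le> N pH pH \<longleftrightarrow> \<beta> / (1 - \<beta>) * w (\<gamma> * pL) \<le> \<beta> * c pH"
  "N pH pH \<le> N pH pL \<longleftrightarrow> \<beta> * c pH \<le> \<beta> / (1 - \<beta>) * w (\<gamma> * pL)"
  unfolding N_equal_prices throughput1_le_iff le_throughput1_iff extreme_prices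
  using above_demand_share by argo+

lemma ratio_coefficient_iff:
  "\<beta> / (1 - \<beta>) * x \<le> \<beta> * y \<longleftrightarrow> x \<le> (1 - \<beta>) * y"
  "\<beta> * y \<le> \<beta> / (1 - \<beta>) * x \<longleftrightarrow> (1 - \<beta>) * y \<le> x"
proof -
  have "\<beta> / (1 - \<beta>) * x = \<beta> * (x / (1 - \<beta>))"
    by simp
  then show "\<beta> / (1 - \<beta>) * x \<le> \<beta> * y \<longleftrightarrow> x \<le> (1 - \<beta>) * y"
    "\<beta> * y \<le> \<beta> / (1 - \<beta>) * x \<longleftrightarrow> (1 - \<beta>) * y \<le> x"
    using beta by (simp_all add: pos_divide_le_eq pos_le_divide_eq mult.commute)
qed

lemma nash_conditions:
  "throughput_nash w c \<beta> \<gamma> pL pH (pL, pL) \<longleftrightarrow>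
     c pH \<le> \<beta> * w (\<gamma> * pL) \<and> c pH \<le> (1 - \<beta>) * w (\<gamma> * pL)"
  "throughput_nash w c \<beta> \<gamma> pL pH (pL, pH) \<longleftrightarrow>
     \<beta> * c pH \<le> w (\<gamma> * pL) \<and> (1 - \<beta>) * w (\<gamma> * pL) \<le> c pH"
  "throughput_nash w c \<beta> \<gamma> pL pH (pH, pL) \<longleftrightarrow>
     \<beta> * w (\<gamma> * pL) \<le> c pH \<and> (1 - \<beta>) * c pH \<le> w (\<gamma> * pL)"
  "throughput_nash w c \<beta> \<gamma> pL pH (pH, pH) \<longleftrightarrow>
     w (\<gamma> * pL) \<le> \<beta> * c pH \<and> w (\<gamma> * pL) \<le> (1 - \<beta>) * c pH"
  unfolding throughput_nash_iff[OF beta]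
  by (simp_all only: ball_simps N_LH_versus_LL N_HL_versus_LL N_LH_versus_HH N_HL_versus_HH
      ratio_coefficient_iff order_refl) auto

end

text \<open>A price below \<open>pbal\<close> has supply below and demand above the common value at \<open>pbal\<close>, and a
  price above \<open>pbal\<close> the reverse; comparing through that value gives all four strict inequalities
  between scarce and abundant quantities.\<close>

lemma scarce_sides_around_balance_price:
  assumes beta: "0 < \<beta>" "\<beta> < 1" and "0 < \<gamma>"
    and sd: "supply_demand w c" and bal: "balance_price w c \<gamma> pbal"
    and "0 < pL" "pL < pbal" "pbal < pH"
  shows "scarce_sides w c \<beta> \<gamma> pL pH"
proof -
  have pos: "w p > 0" "c p > 0" if "p > 0" for p
    using sd that by (auto simp: supply_demand_def)
  have mono: "w p < w q" "c q < c p" if "0 < p" "p < q" for p q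
    using sd that by (auto simp: supply_demand_def monotone_on_def)
  have supply_less: "w (\<gamma> * pL) < w (\<gamma> * pbal)" "w (\<gamma> * pbal) < w (\<gamma> * pH)"
    using assms by (auto intro!: mono(1))
  have demand_less: "c pbal < c pL" "c pH < c pbal"
    using assms by (auto intro!: mono(2))
  have "w (\<gamma> * pbal) = c pbal"
    using bal by (simp add: balance_price_def)
  with supply_less demand_less show ?thesis
    using assms by unfold_locales (auto intro!: pos)
qed

theorem theorem2:
  fixes w c :: "real \<Rightarrow> real" and \<beta> \<gamma> pL pH pbal \<rho> :: real
  assumes "0 < \<beta>" "\<beta> < 1" and "0 < \<gamma>" "\<gamma> < 1"
    and "supply_demand w c"
    and "balance_price w c \<gamma> pbal"
    and "0 < pL" and "pL < pbal" and "pbal < pH"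
    and "\<rho> = c pH / w (\<gamma> * pL)"
  shows
    "(throughput_nash w c \<beta> \<gamma> pL pH (pL, pL) \<longleftrightarrow>
        max \<rho> 0 \<le> \<beta> \<and> \<beta> \<le> min (1 - \<rho>) 1) \<and>
     (throughput_nash w c \<beta> \<gamma> pL pH (pL, pH) \<longleftrightarrow>
        max (1 - \<rho>) 0 \<le> \<beta> \<and> \<beta> \<le> min (1 / \<rho>) 1) \<and>
     (throughput_nash w c \<beta> \<gamma> pL pH (pH, pL) \<longleftrightarrow>
        max (1 - 1 / \<rho>) 0 \<le> \<beta> \<and> \<beta> \<le> min \<rho> 1) \<and>
     (throughput_nash w c \<beta> \<gamma> pL pH (pH, pH) \<longleftrightarrow>
        max (1 / \<rho>) 0 \<le> \<beta> \<and> \<beta> \<le> min (1 - 1 / \<rho>) 1)"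
proof -
  interpret scarce_sides w c \<beta> \<gamma> pL pH
    by (rule scarce_sides_around_balance_price) fact+
  have "1 / \<rho> = w (\<gamma> * pL) / c pH"
    using \<open>\<rho> = c pH / w (\<gamma> * pL)\<close> by simp
  have rho_iff: "\<rho> \<le> x \<longleftrightarrow> c pH \<le> x * w (\<gamma> * pL)" "x \<le> \<rho> \<longleftrightarrow> x * w (\<gamma> * pL) \<le> c pH" for x
    unfolding \<open>\<rho> = c pH / w (\<gamma> * pL)\<close>
    using scarce_pos by (simp_all add: pos_divide_le_eq pos_le_divide_eq)
  have inverse_rho_iff:
    "1 / \<rho> \<le> x \<longleftrightarrow> w (\<gamma> * pL) \<le> x * c pH" "x \<le> 1 / \<rho> \<longleftrightarrow> x * c pH \<le> w (\<gamma> * pL)" for x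
    unfolding \<open>1 / \<rho> = w (\<gamma> * pL) / c pH\<close>
    using scarce_pos by (simp_all add: pos_divide_le_eq pos_le_divide_eq)
  have reflect: "\<beta> \<le> 1 - x \<longleftrightarrow> x \<le> 1 - \<beta>" "1 - x \<le> \<beta> \<longleftrightarrow> 1 - \<beta> \<le> x" for x
    by auto
  show ?thesis
    unfolding nash_conditions max.bounded_iff min.bounded_iff reflect rho_iff inverse_rho_iff
    using beta by auto
qed

end
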